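(* Let $\Omega_i=\mathbb R^p$ for all $i$. Suppose each $f_i:\mathbb R^p\to\mathbb R$ is convex and differentiable with $L_i$-Lipschitz gradient, the graph $\mathcal G$ is connected, and $\mathbf L=U^\top U$ satisfies the graph and null-space conditions given in the context. Assume that the problem of minimizing $\sum_{i=1}^nf_i(x_i)$ subject to $\sum_{i=1}^n(x_i-r_i)=0$ has a solution. Let $L=\max_iL_i$ and $0<c<\frac1{2L\lambda_{\max}(\mathbf L)}$. Then, along the iterates of Mirror-EXTRA, the first-order optimality residual decays to $0$ at an $o(1/k)$ rate, i.e. $$\|U\nabla\mathbf f(\mathbf x^{k+1})\|_{\mathrm F}^2=o\!\left(\tfrac1k\right),\qquad\|\mathbf x^{k+1}-\mathbf r+cU^\top\mathbf q^{k+1}\|_{\mathrm F}^2=o\!\left(\tfrac1k\right).$$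
   Context: Agents $i=1,\dots,n$ have $f_i:\mathbb R^p\to\mathbb R$ and $r_i\in\mathbb R^p$. Points are matrices $\mathbf x\in\mathbb R^{n\times p}$ with $i$-th row $x_i^\top$; $\mathbf r$ has rows $r_i^\top$; $\nabla\mathbf f(\mathbf x)$ is the matrix with rows $(\nabla f_i(x_i))^\top$. $\lambda_{\max}$ is the largest eigenvalue; $\|\cdot\|_{\mathrm F}$ the Frobenius norm. Graph. $\mathcal G$ is a simple undirected graph on $\{1,\dots,n\}$ with edge set $\mathcal E$ and neighbor sets $\mathcal N_i$. The $n\times n$ matrix $\mathbf L=[L_{ij}]$ is compatible with $\mathcal G$ (that is, $L_{ij}=0$ whenever $i\ne j$ and $\{i,j\}\notin\mathcal E$) and $\mathbf L=U^\top U$ for some full-row-rank $U\in\mathbb R^{(n-1)\times n}$ with null space $\{a\mathbf 1: a\in\mathbb R\}$. Algorithm (Mirror-EXTRA). Each agent $i$ initializes with arbitrary $x_i^0\in\mathbb R^p$ and $y_i^{-1}=0$. For $k=0,1,\dots$: $y_i^k=y_i^{k-1}+\sum_{j\in\mathcal N_i\cup\{i\}}L_{ij}\nabla f_j(x_j^k)$; $x_i^{k+1}=r_i-2cy_i^k+cy_i^{k-1}$. Define $\mathbf q^{-1}=0$ and $\mathbf q^k=\mathbf q^{k-1}+U\nabla\mathbf f(\mathbf x^k)$ for $k\ge0$. A nonnegative sequence $\{a_k\}$ is $o(1/k)$ if $\limsup_{k\to\infty}ka_k=0$. *)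

theory Defs
  imports "HOL-Analysis.Analysis"
begin

text \<open>
  A family of points \<open>x\<^sub>i\<close> in p-dimensional Euclidean space, one per agent, is the matrix
  \<open>x :: real^'p^'n\<close> with rows \<open>x $ i\<close>; the library norm of this type is the Frobenius norm.
\<close>

definition gradient :: "('a::real_inner \<Rightarrow> real) \<Rightarrow> 'a \<Rightarrow> 'a" where
  "gradient f x = (THE D. GDERIV f x :> D)"

definition stacked_gradient :: "('n \<Rightarrow> real^'p \<Rightarrow> real) \<Rightarrow> real^'p^'n \<Rightarrow> real^'p^'n" where
  "stacked_gradient f x = (\<chi> i. gradient (f i) (x $ i))"

text \<open>The vertices of a graph are all elements of the type; it is given by its set of edges.\<close>

definition simple_graph :: "'n set set \<Rightarrow> bool" where
  "simple_graph E \<longleftrightarrow> (\<forall>e\<in>E. card e = 2)"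

definition neighbors :: "'n set set \<Rightarrow> 'n \<Rightarrow> 'n set" where
  "neighbors E i = {j. {i, j} \<in> E}"

definition connected_graph :: "'n set set \<Rightarrow> bool" where
  "connected_graph E \<longleftrightarrow> (\<forall>i j. (i, j) \<in> {(u, v). {u, v} \<in> E}\<^sup>*)"

definition graph_compatible :: "'n set set \<Rightarrow> real^'n^'n \<Rightarrow> bool" where
  "graph_compatible E A \<longleftrightarrow> (\<forall>i j. i \<noteq> j \<and> {i, j} \<notin> E \<longrightarrow> A $ i $ j = 0)"

definition is_eigenvalue :: "real^'n^'n \<Rightarrow> real \<Rightarrow> bool" where
  "is_eigenvalue A l \<longleftrightarrow> (\<exists>v. v \<noteq> 0 \<and> A *v v = l *\<^sub>R v)"

definition lambda_max :: "real^'n^'n \<Rightarrow> real" where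
  "lambda_max A = (GREATEST l. is_eigenvalue A l)"

text \<open>The sequences \<open>y\<close> and \<open>q\<close> start at index \<open>-1\<close>, hence are indexed by integers.\<close>

definition mirror_extra ::
  "('n \<Rightarrow> real^'p \<Rightarrow> real) \<Rightarrow> real^'p^'n \<Rightarrow> 'n set set \<Rightarrow> real^'n^'n \<Rightarrow> real
    \<Rightarrow> (nat \<Rightarrow> real^'p^'n) \<Rightarrow> (int \<Rightarrow> real^'p^'n) \<Rightarrow> bool" where
  "mirror_extra f r E A c x y \<longleftrightarrow>
     (\<forall>i. y (-1) $ i = 0) \<and>
     (\<forall>k::nat. \<forall>i.
        y (int k) $ i = y (int k - 1) $ i
          + (\<Sum>j\<in>neighbors E i \<union> {i}. A $ i $ j *\<^sub>R gradient (f j) (x k $ j)) \<and>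
        x (k + 1) $ i = r $ i - (2 * c) *\<^sub>R y (int k) $ i + c *\<^sub>R y (int k - 1) $ i)"

definition dual_sequence ::
  "('n \<Rightarrow> real^'p \<Rightarrow> real) \<Rightarrow> real^'n^'m \<Rightarrow> (nat \<Rightarrow> real^'p^'n) \<Rightarrow> (int \<Rightarrow> real^'p^'m) \<Rightarrow> bool" where
  "dual_sequence f U x q \<longleftrightarrow>
     q (-1) = 0 \<and>
     (\<forall>k::nat. q (int k) = q (int k - 1) + U ** stacked_gradient f (x k))"

definition little_o_inverse :: "(nat \<Rightarrow> real) \<Rightarrow> bool" where
  "little_o_inverse a \<longleftrightarrow>
     (\<forall>k. 0 \<le> a k) \<and> limsup (\<lambda>k. ereal (real k * a k)) = 0"

end

theory Submission
  imports Defs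
begin

text \<open>
  Write \<open>q k\<close> for the dual sequence and \<open>d k = U \<nabla>f(x k)\<close> for its increments. The algorithm reads
  \<open>x (k + 1) = r - c U\<^sup>T (q k + d k)\<close>, see \<open>mirror_extra_dual_form\<close>. Hence the first residual
  is \<open>d (k + 1)\<close> and the second is \<open>c U\<^sup>T (d (k + 1) - d k)\<close>. It suffices to show that
  \<open>V k = \<bar>d (k + 1)\<bar>\<^sup>2 + \<bar>d (k + 1) - d k\<bar>\<^sup>2\<close> is summable and nonincreasing, because such a sequence is
  \<open>o(1 / k)\<close>.

  Both properties come from one inequality. The gradients are cocoercive by the theorem of Baillon
  and Haddad (\<open>gradient_cocoercive\<close>), and \<open>\<bar>U H\<bar>\<^sup>2\<close> is at most \<open>\<lambda>\<^sub>m\<^sub>a\<^sub>x \<bar>H\<bar>\<^sup>2\<close>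
  (\<open>norm_factor_mult_le\<close>), so the bound on the step size gives, for all points \<open>a\<close> and \<open>b\<close>,

  \<open>2 c \<bar>U (\<nabla>f a - \<nabla>f b)\<bar>\<^sup>2 \<le> \<langle>\<nabla>f a - \<nabla>f b, a - b\<rangle>\<close>.

  If \<open>a - b\<close> has the form \<open>- c U\<^sup>T w\<close>, the right-hand side is \<open>- c \<langle>U (\<nabla>f a - \<nabla>f b), w\<rangle>\<close>, and only
  dual quantities remain. One choice for \<open>b\<close> is a solution \<open>z\<close> of the problem: there
  \<open>U \<nabla>f(z) = 0\<close> (\<open>minimizer_gradient_consensus\<close>) and \<open>z = r - c U\<^sup>T s\<close> for some \<open>s\<close>
  (\<open>zero_row_sum_in_range\<close>). It yields a Lyapunov function which shows that \<open>\<bar>d k\<bar>\<^sup>2\<close> is summable. The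
  other choice is the preceding iterate, which yields the monotonicity of \<open>V\<close>. Both arguments
  take place in \<open>increments_rate\<close>.
\<close>

section \<open>Gradients of convex functions\<close>

lemma gderiv_gradient:
  fixes f :: "'a::euclidean_space \<Rightarrow> real"
  assumes "f differentiable (at z)"
  shows "GDERIV f z :> gradient f z"
proof -
  obtain F where F: "(f has_derivative F) (at z)"
    using assms by (auto simp: differentiable_def)
  then have "linear F" by (rule has_derivative_linear)
  then have "F = (\<lambda>h. inner h (adjoint F 1))"
    by (simp add: adjoint_works fun_eq_iff)
  with F have ex: "GDERIV f z :> adjoint F 1" by (simp add: gderiv_def)
  have unique: "D = D'" if "GDERIV f z :> D" "GDERIV f z :> D'" for D D'
  proof -
    have "(\<lambda>h. inner h D) = (\<lambda>h. inner h D')"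
      using that unfolding gderiv_def by (rule has_derivative_unique)
    then have "inner (D - D') D = inner (D - D') D'" by meson
    then have "inner (D - D') (D - D') = 0" by (simp add: inner_diff_right)
    then show ?thesis by simp
  qed
  show ?thesis
    unfolding gradient_def using theI[of "\<lambda>D. GDERIV f z :> D", OF ex unique[OF _ ex]] .
qed

lemma gradient_along_line:
  fixes f :: "'a::euclidean_space \<Rightarrow> real"
  assumes "\<And>z. f differentiable (at z)"
  shows "((\<lambda>t. f (x + t *\<^sub>R v)) has_real_derivative inner v (gradient f (x + t *\<^sub>R v))) (at t)"
proof -
  have outer: "(f has_derivative (\<lambda>h. inner h (gradient f (x + t *\<^sub>R v)))) (at (x + t *\<^sub>R v))"
    using gderiv_gradient[OF assms] by (simp add: gderiv_def)
  have "((\<lambda>t. x + t *\<^sub>R v) has_derivative (\<lambda>h. h *\<^sub>R v)) (at t)"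
    by (auto intro!: derivative_eq_intros)
  from diff_chain_at[OF this outer] have "((\<lambda>t. f (x + t *\<^sub>R v)) has_derivative
      (\<lambda>h. inner (h *\<^sub>R v) (gradient f (x + t *\<^sub>R v)))) (at t)"
    by (simp only: o_def)
  then show ?thesis by (simp add: has_field_derivative_def mult_commute_abs)
qed

text \<open>
  The restriction of f to a line is a convex function of one real variable, for which the tangent
  inequality is known.
\<close>

lemma convex_above_tangent:
  fixes f :: "'a::euclidean_space \<Rightarrow> real"
  assumes "convex_on UNIV f" and diff: "\<And>z. f differentiable (at z)"
  shows "f x + inner (gradient f x) v \<le> f (x + v)"
proof -
  have "convex_on UNIV (\<lambda>t::real. f (x + t *\<^sub>R v))"
    unfolding convex_on_def
  proof (intro conjI ballI allI impI)
    fix s t u w :: real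
    assume uw: "0 \<le> u" "0 \<le> w" "u + w = 1"
    have "x + (u *\<^sub>R s + w *\<^sub>R t) *\<^sub>R v = (u + w) *\<^sub>R x + (u *\<^sub>R s + w *\<^sub>R t) *\<^sub>R v"
      using uw by simp
    also have "\<dots> = u *\<^sub>R (x + s *\<^sub>R v) + w *\<^sub>R (x + t *\<^sub>R v)"
      by (simp add: algebra_simps)
    finally show "f (x + (u *\<^sub>R s + w *\<^sub>R t) *\<^sub>R v) \<le> u * f (x + s *\<^sub>R v) + w * f (x + t *\<^sub>R v)"
      using assms(1) uw by (simp add: convex_on_def)
  qed simp
  from convex_on_imp_above_tangent[OF this, of 0 1 "inner v (gradient f x)"]
    gradient_along_line[of f x v 0, OF diff]
  show ?thesis by (simp add: inner_commute)
qed

text \<open>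
  Along the segment from \<open>x\<close> to \<open>x + v\<close>, the derivative of f exceeds its initial value by at most
  \<open>L t \<bar>v\<bar>\<^sup>2\<close>, because the gradient is Lipschitz; hence f minus the quadratic bound is nonincreasing.
\<close>

lemma quadratic_upper_bound:
  fixes f :: "'a::euclidean_space \<Rightarrow> real"
  assumes diff: "\<And>z. f differentiable (at z)" and lip: "L-lipschitz_on UNIV (gradient f)"
  shows "f (x + v) \<le> f x + inner (gradient f x) v + L / 2 * (norm v)\<^sup>2"
proof -
  define \<psi> where
    "\<psi> t = f (x + t *\<^sub>R v) - (t * inner v (gradient f x) + L / 2 * t\<^sup>2 * (norm v)\<^sup>2)" for t
  have "\<psi> 1 \<le> \<psi> 0"
  proof (rule DERIV_nonpos_imp_nonincreasing[where f = \<psi> and a = 0 and b = 1])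
    fix t :: real assume t: "0 \<le> t" "t \<le> 1"
    let ?g = "gradient f (x + t *\<^sub>R v) - gradient f x"
    have "((\<lambda>t. t * inner v (gradient f x) + L / 2 * t\<^sup>2 * (norm v)\<^sup>2) has_real_derivative
        inner v (gradient f x) + L * t * (norm v)\<^sup>2) (at t)"
      by (auto intro!: derivative_eq_intros)
    from DERIV_diff[OF gradient_along_line[OF diff] this]
    have deriv: "(\<psi> has_real_derivative inner v ?g - L * t * (norm v)\<^sup>2) (at t)"
      unfolding \<psi>_def[abs_def] inner_diff_right diff_diff_add .
    have "norm ?g \<le> L * (t * norm v)"
      using lipschitz_onD[OF lip, of "x + t *\<^sub>R v" x] t by (simp add: dist_norm)
    then have "norm v * norm ?g \<le> norm v * (L * (t * norm v))"
      by (rule mult_left_mono) simp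
    with norm_cauchy_schwarz[of v ?g]
    have "inner v ?g \<le> L * t * (norm v)\<^sup>2"
      by (simp add: power2_eq_square mult_ac)
    with deriv show "\<exists>y. (\<psi> has_real_derivative y) (at t) \<and> y \<le> 0"
      by (intro exI[of _ "inner v ?g - L * t * (norm v)\<^sup>2"] conjI) auto
  qed simp
  then show ?thesis by (simp add: \<psi>_def inner_commute[of v])
qed

text \<open>
  Subtracting from f its tangent at one point gives a convex function whose minimum is at that
  point. The minimum is at most the value after one gradient step of length \<open>1 / L\<close> from the other
  point, and that step gains \<open>\<bar>\<nabla>f x - \<nabla>f y\<bar>\<^sup>2 / (2 L)\<close>. Adding the two inequalities obtained by
  exchanging the points gives the Baillon-Haddad inequality; writing it without division keeps
  the case \<open>L = 0\<close>.
\<close>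

lemma gradient_cocoercive:
  fixes f :: "'a::euclidean_space \<Rightarrow> real"
  assumes convex: "convex_on UNIV f" and diff: "\<And>z. f differentiable (at z)"
    and lip: "L-lipschitz_on UNIV (gradient f)"
  shows "(norm (gradient f x - gradient f y))\<^sup>2 \<le> L * inner (gradient f x - gradient f y) (x - y)"
proof (cases "L = 0")
  case True
  with lipschitz_onD[OF lip, of x y] show ?thesis by simp
next
  case False
  then have L: "0 < L" using lipschitz_on_nonneg[OF lip] by simp
  have half: "f x + inner (gradient f x) (y - x) + (norm (gradient f x - gradient f y))\<^sup>2 / (2 * L) \<le> f y" for x y
  proof -
    define h where "h = gradient f x - gradient f y"
    \<comment> \<open>this step minimises the quadratic upper bound at \<open>y\<close> of f minus its tangent at \<open>x\<close>\<close>
    define v where "v = (1 / L) *\<^sub>R h"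
    have "f x + inner (gradient f x) (y + v - x) \<le> f (y + v)"
      using convex_above_tangent[OF convex diff, of x "y + v - x"] by simp
    also have "\<dots> \<le> f y + inner (gradient f y) v + L / 2 * (norm v)\<^sup>2"
      by (rule quadratic_upper_bound[OF diff lip])
    also have "L / 2 * (norm v)\<^sup>2 = (norm h)\<^sup>2 / (2 * L)"
      using L by (simp add: v_def field_simps power2_eq_square)
    finally have "f x + inner (gradient f x) (y - x) + inner h v \<le> f y + (norm h)\<^sup>2 / (2 * L)"
      by (simp add: h_def inner_add_right inner_diff_right inner_diff_left)
    moreover have "inner h v = (norm h)\<^sup>2 / (2 * L) + (norm h)\<^sup>2 / (2 * L)"
      using L by (simp add: v_def power2_norm_eq_inner)
    ultimately show ?thesis unfolding h_def by linarith
  qed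
  have "(norm (gradient f x - gradient f y))\<^sup>2 / L \<le> inner (gradient f x - gradient f y) (x - y)"
    using half[of x y] half[of y x, unfolded norm_minus_commute[of "gradient f y"]]
    by (simp add: inner_diff_left inner_diff_right)
  with L show ?thesis by (simp add: field_simps)
qed

section \<open>The largest eigenvalue\<close>

text \<open>
  This is how first-order conditions are read off a minimum below, both for the Rayleigh quotient
  and for the constrained problem: near \<open>t = 0\<close> the linear term would otherwise dominate.
\<close>

lemma linear_coefficient_zero:
  fixes a b :: real
  assumes "\<And>t. 0 \<le> t * b + t\<^sup>2 * a"
  shows "b = 0"
proof (rule ccontr)
  assume "b \<noteq> 0"
  \<comment> \<open>the quadratic is negative at \<open>- b / m\<close> as soon as \<open>m\<close> is positive and exceeds \<open>a\<close>\<close>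
  define m where "m = \<bar>a\<bar> + 1"
  have m: "0 < m" "a < m" by (auto simp: m_def)
  have "(- b / m) * b + (- b / m)\<^sup>2 * a = (b / m)\<^sup>2 * (a - m)"
  proof -
    define s where "s = b / m"
    then have "b = s * m" using m by simp
    then show ?thesis using m by (simp add: power2_eq_square algebra_simps)
  qed
  also have "\<dots> < 0" using m \<open>b \<noteq> 0\<close> by (intro mult_pos_neg) auto
  finally show False using assms[of "- b / m"] by simp
qed

lemma inner_transpose_vector:
  fixes A :: "real^'n^'m"
  shows "inner (transpose A *v u) v = inner u (A *v v)"
  by (simp add: dot_lmul_matrix)

text \<open>
  By compactness the quadratic form has a maximum \<open>M\<close> on the unit sphere, attained at some \<open>w\<close>. Then
  \<open>M - A\<close> is positive semidefinite and its form vanishes at \<open>w\<close>, which forces \<open>A w = M w\<close>. No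
  eigenvalue exceeds \<open>M\<close>, so \<open>M\<close> is the greatest one; in particular the greatest eigenvalue
  exists.
\<close>

lemma rayleigh_le_lambda_max:
  fixes A :: "real^'n::finite^'n"
  assumes sym: "transpose A = A"
  shows "inner v (A *v v) \<le> lambda_max A * (norm v)\<^sup>2"
proof -
  have "continuous_on (sphere 0 1) (\<lambda>v. inner v (A *v v))"
    by (intro continuous_intros linear_continuous_on) (simp add: linear_linear)
  then obtain w :: "real^'n" where w: "norm w = 1"
    and wmax: "\<And>v. norm v = 1 \<Longrightarrow> inner v (A *v v) \<le> inner w (A *v w)"
    using continuous_attains_sup[of "sphere (0::real^'n) 1" "\<lambda>v. inner v (A *v v)"] by auto
  define M where "M = inner w (A *v w)"
  have bound: "inner v (A *v v) \<le> M * (norm v)\<^sup>2" for v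
  proof (cases "v = 0")
    case False
    have "inner (sgn v) (A *v sgn v) \<le> M"
      unfolding M_def using False by (intro wmax) (simp add: norm_sgn)
    moreover have "inner (sgn v) (A *v sgn v) = inner v (A *v v) / (norm v)\<^sup>2"
      by (simp add: sgn_div_norm matrix_vector_mult_scaleR power2_eq_square divide_inverse)
    ultimately show ?thesis using False by (simp add: field_simps)
  qed simp
  have swap: "inner (A *v u) v = inner u (A *v v)" for u v
    using inner_transpose_vector[of A u v] by (simp only: sym)
  have "is_eigenvalue A M"
  proof -
    \<comment> \<open>perturbing \<open>w\<close> in the direction of the residual shows that the residual vanishes\<close>
    define \<rho> where "\<rho> = M *\<^sub>R w - A *v w"
    have cross: "inner w (A *v \<rho>) = inner \<rho> (A *v w)"
      using swap[of w \<rho>] by (simp only: inner_commute)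
    have "0 \<le> t * (2 * inner \<rho> \<rho>) + t\<^sup>2 * (M * (norm \<rho>)\<^sup>2 - inner \<rho> (A *v \<rho>))" for t
    proof -
      have sq: "(norm (w + t *\<^sub>R \<rho>))\<^sup>2 = 1 + 2 * t * inner \<rho> w + t\<^sup>2 * (norm \<rho>)\<^sup>2"
        using w unfolding power2_norm_eq_inner norm_eq_1
        by (simp add: inner_add_left inner_add_right inner_commute[of w \<rho>] power2_eq_square distrib_left)
      have form: "inner (w + t *\<^sub>R \<rho>) (A *v (w + t *\<^sub>R \<rho>)) =
          M + 2 * t * inner \<rho> (A *v w) + t\<^sup>2 * inner \<rho> (A *v \<rho>)"
        using cross
        by (simp add: M_def inner_add_left inner_add_right matrix_vector_right_distrib
            matrix_vector_mult_scaleR power2_eq_square distrib_left)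
      have "inner \<rho> \<rho> = M * inner \<rho> w - inner \<rho> (A *v w)"
        unfolding \<rho>_def[THEN arg_cong, of "inner \<rho>"] by (simp add: inner_diff_right)
      then have "t * (2 * inner \<rho> \<rho>) + t\<^sup>2 * (M * (norm \<rho>)\<^sup>2 - inner \<rho> (A *v \<rho>)) =
          M * (norm (w + t *\<^sub>R \<rho>))\<^sup>2 - inner (w + t *\<^sub>R \<rho>) (A *v (w + t *\<^sub>R \<rho>))"
        unfolding sq form by (simp add: right_diff_distrib distrib_left)
      with bound[of "w + t *\<^sub>R \<rho>"] show ?thesis by simp
    qed
    then have "2 * inner \<rho> \<rho> = 0" by (rule linear_coefficient_zero)
    then have "A *v w = M *\<^sub>R w" by (simp add: \<rho>_def)
    moreover have "w \<noteq> 0" using w by auto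
    ultimately show ?thesis unfolding is_eigenvalue_def by blast
  qed
  moreover have "l \<le> M" if "is_eigenvalue A l" for l
  proof -
    obtain v where "v \<noteq> 0" "A *v v = l *\<^sub>R v"
      using \<open>is_eigenvalue A l\<close> by (auto simp: is_eigenvalue_def)
    then show ?thesis using bound[of v] by (simp add: power2_norm_eq_inner)
  qed
  ultimately have "lambda_max A = M"
    unfolding lambda_max_def by (rule Greatest_equality)
  with bound show ?thesis by simp
qed

section \<open>Matrices as families of rows\<close>

lemma inner_transpose_matrix:
  fixes A :: "real^'n::finite^'m::finite" and H :: "real^'p::finite^'n"
  shows "inner (transpose A ** Q) H = inner Q (A ** H)"
proof -
  have "inner (transpose A ** Q) H = (\<Sum>i\<in>UNIV. \<Sum>j\<in>UNIV. \<Sum>k\<in>UNIV. A $ k $ i * Q $ k $ j * H $ i $ j)"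
    by (simp add: inner_vec_def matrix_matrix_mult_def transpose_def sum_distrib_right)
  also have "\<dots> = (\<Sum>k\<in>UNIV. \<Sum>j\<in>UNIV. \<Sum>i\<in>UNIV. A $ k $ i * Q $ k $ j * H $ i $ j)"
    by (subst sum.swap, subst (2) sum.swap, subst sum.swap, rule refl)
  also have "\<dots> = inner Q (A ** H)"
    by (simp add: inner_vec_def matrix_matrix_mult_def sum_distrib_left mult_ac)
  finally show ?thesis .
qed

lemma column_matrix_mult: "column j (A ** H) = A *v column j H"
  by (simp add: column_def matrix_matrix_mult_def matrix_vector_mult_def vec_eq_iff)

lemma norm_squared_columns:
  fixes H :: "real^'p::finite^'n::finite"
  shows "(norm H)\<^sup>2 = (\<Sum>j\<in>UNIV. (norm (column j H))\<^sup>2)"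
  unfolding power2_norm_eq_inner inner_vec_def column_def vec_lambda_beta by (rule sum.swap)

lemma linear_matrix_mult: "linear (\<lambda>H::real^'p::finite^'n::finite. (A::real^'n^'m::finite) ** H)"
  by (rule linearI) (simp_all add: matrix_add_ldistrib matrix_scalar_ac scalar_matrix_assoc)

text \<open>
  The Frobenius norm splits over columns, and U acts on each column separately, so the Rayleigh
  bound for vectors carries over to matrices.
\<close>

lemma norm_factor_mult_le:
  fixes U :: "real^'n::finite^'m::finite" and H :: "real^'p::finite^'n"
  shows "(norm (U ** H))\<^sup>2 \<le> lambda_max (transpose U ** U) * (norm H)\<^sup>2"
proof -
  have "(norm (U *v v))\<^sup>2 \<le> lambda_max (transpose U ** U) * (norm v)\<^sup>2" for v
  proof -
    have "(norm (U *v v))\<^sup>2 = inner v ((transpose U ** U) *v v)"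
      using inner_transpose_vector[of U "U *v v" v]
      by (simp only: power2_norm_eq_inner matrix_vector_mul_assoc inner_commute)
    also have "\<dots> \<le> lambda_max (transpose U ** U) * (norm v)\<^sup>2"
      by (rule rayleigh_le_lambda_max) (simp add: matrix_transpose_mul)
    finally show ?thesis .
  qed
  then show ?thesis
    by (simp add: norm_squared_columns column_matrix_mult sum_distrib_left sum_mono)
qed

section \<open>Optimality conditions\<close>

lemma stacked_gradient_cocoercive:
  fixes f :: "'n::finite \<Rightarrow> real^'p::finite \<Rightarrow> real"
  assumes "\<And>i. convex_on UNIV (f i)" "\<And>i z. f i differentiable (at z)"
    and "\<And>i. L-lipschitz_on UNIV (gradient (f i))"
  shows "(norm (stacked_gradient f x - stacked_gradient f y))\<^sup>2
    \<le> L * inner (stacked_gradient f x - stacked_gradient f y) (x - y)"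
proof -
  have "(\<Sum>i\<in>UNIV. (norm (gradient (f i) (x $ i) - gradient (f i) (y $ i)))\<^sup>2)
      \<le> (\<Sum>i\<in>UNIV. L * inner (gradient (f i) (x $ i) - gradient (f i) (y $ i)) (x $ i - y $ i))"
    by (intro sum_mono gradient_cocoercive assms)
  then show ?thesis
    unfolding power2_norm_eq_inner inner_vec_def[where 'a = "real^'p"]
    by (simp add: stacked_gradient_def sum_distrib_left)
qed

lemma stacked_quadratic_upper_bound:
  fixes f :: "'n::finite \<Rightarrow> real^'p::finite \<Rightarrow> real"
  assumes "\<And>i z. f i differentiable (at z)" "\<And>i. L-lipschitz_on UNIV (gradient (f i))"
  shows "(\<Sum>i\<in>UNIV. f i ((z + v) $ i)) \<le>
    (\<Sum>i\<in>UNIV. f i (z $ i)) + inner (stacked_gradient f z) v + L / 2 * (norm v)\<^sup>2"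
proof -
  have "(\<Sum>i\<in>UNIV. f i ((z + v) $ i)) \<le>
    (\<Sum>i\<in>UNIV. f i (z $ i) + inner (gradient (f i) (z $ i)) (v $ i) + L / 2 * (norm (v $ i))\<^sup>2)"
    unfolding vector_add_component by (intro sum_mono quadratic_upper_bound assms)
  then show ?thesis
    unfolding power2_norm_eq_inner inner_vec_def[where 'a = "real^'p"]
    by (simp add: sum.distrib sum_distrib_left stacked_gradient_def)
qed

lemma sum_rows_transpose_mult:
  fixes U :: "real^'n::finite^'m::finite" and Q :: "real^'p::finite^'m"
  assumes "U *v 1 = 0"
  shows "(\<Sum>i\<in>UNIV. (transpose U ** Q) $ i) = 0"
proof (rule vec_eq_iff[THEN iffD2], rule allI)
  fix j
  have zero: "(\<Sum>i\<in>UNIV. U $ k $ i) = 0" for k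
    using assms by (simp add: matrix_vector_mult_def vec_eq_iff)
  have "(\<Sum>i\<in>UNIV. (transpose U ** Q) $ i) $ j = (\<Sum>i\<in>UNIV. \<Sum>k\<in>UNIV. U $ k $ i * Q $ k $ j)"
    by (simp add: matrix_matrix_mult_def transpose_def)
  also have "\<dots> = (\<Sum>k\<in>UNIV. (\<Sum>i\<in>UNIV. U $ k $ i) * Q $ k $ j)"
    by (subst sum.swap) (simp add: sum_distrib_right)
  also have "\<dots> = 0" by (simp add: zero)
  finally show "(\<Sum>i\<in>UNIV. (transpose U ** Q) $ i) $ j = 0 $ j" by simp
qed

text \<open>
  The range of the transpose of U is the orthogonal complement of the kernel of U. That kernel
  consists of the matrices with equal rows, so its complement consists of the matrices whose rows
  sum to zero.
\<close>

lemma zero_row_sum_in_range: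
  fixes U :: "real^'n::finite^'m::finite" and X :: "real^'p::finite^'n"
  assumes null: "{v. U *v v = 0} = {a *\<^sub>R 1 | a. True}" and sum0: "(\<Sum>i\<in>UNIV. X $ i) = 0"
  shows "\<exists>Q. X = transpose U ** Q"
proof -
  have "U *v (1 *\<^sub>R 1) = 0" using null by blast
  then have one: "U *v 1 = 0" by simp
  let ?S = "range (\<lambda>Q :: real^'p^'m. transpose U ** Q)"
  have span: "span ?S = ?S"
    by (intro span_eq_iff[THEN iffD2] linear_subspace_image linear_matrix_mult subspace_UNIV)
  obtain Y Z where "Y \<in> span ?S" and orth: "\<And>W. W \<in> span ?S \<Longrightarrow> orthogonal Z W"
    and X: "X = Y + Z"
    using orthogonal_subspace_decomp_exists[of ?S X] by blast
  then obtain Q where Y: "Y = transpose U ** Q" using span by auto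
  have "inner (U ** Z) (U ** Z) = inner (transpose U ** (U ** Z)) Z"
    by (simp add: inner_transpose_matrix)
  also have "\<dots> = 0"
    using orth[of "transpose U ** (U ** Z)"] span by (auto simp: orthogonal_def inner_commute)
  finally have "U ** Z = 0" by simp
  then have "U *v column j Z = 0" for j
    by (simp flip: column_matrix_mult) (simp add: column_def vec_eq_iff)
  then have "\<exists>a. column j Z = a *\<^sub>R 1" for j using null by blast
  then obtain a where "\<And>j. column j Z = a j *\<^sub>R 1" by metis
  then have "Z $ i = (\<chi> j. a j)" for i
    by (simp add: column_def vec_eq_iff)
  moreover have "(\<Sum>i\<in>UNIV. Z $ i) = 0"
    using sum0 sum_rows_transpose_mult[OF one, of Q] by (simp add: X Y sum.distrib)
  ultimately have "real CARD('n) *\<^sub>R (\<chi> j. a j) = (0 :: real^'p)"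
    by (simp only: sum_constant_scaleR)
  then have "a j = 0" for j by (simp add: vec_eq_iff)
  with \<open>\<And>i. Z $ i = (\<chi> j. a j)\<close> have "Z = 0" by (simp add: vec_eq_iff)
  with X Y show ?thesis by auto
qed

text \<open>
  The feasible set is invariant under translation by the range of the transpose of U. Moving from
  the minimizer along \<open>U\<^sup>T U \<nabla>f(z)\<close> changes the objective at first order by \<open>\<bar>U \<nabla>f(z)\<bar>\<^sup>2\<close> times the
  step, which has to vanish.
\<close>

lemma minimizer_gradient_consensus:
  fixes f :: "'n::finite \<Rightarrow> real^'p::finite \<Rightarrow> real" and U :: "real^'n^'m::finite"
  assumes diff: "\<And>i z. f i differentiable (at z)"
    and lip: "\<And>i. L-lipschitz_on UNIV (gradient (f i))"
    and one: "U *v 1 = 0"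
    and min: "is_arg_min (\<lambda>z. \<Sum>i\<in>UNIV. f i (z $ i)) (\<lambda>z. (\<Sum>i\<in>UNIV. z $ i - r $ i) = 0) z"
  shows "U ** stacked_gradient f z = 0"
proof -
  let ?G = "stacked_gradient f z"
  define v where "v = transpose U ** (U ** ?G)"
  have "0 \<le> t * inner ?G v + t\<^sup>2 * (L / 2 * (norm v)\<^sup>2)" for t
  proof -
    have "(\<Sum>i\<in>UNIV. (z + t *\<^sub>R v) $ i - r $ i)
        = (\<Sum>i\<in>UNIV. z $ i - r $ i) + t *\<^sub>R (\<Sum>i\<in>UNIV. v $ i)"
      by (simp add: sum.distrib sum_subtractf scaleR_sum_right)
    also have "\<dots> = 0"
      using min sum_rows_transpose_mult[OF one, of "U ** ?G"] by (simp add: v_def is_arg_min_def)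
    finally have "(\<Sum>i\<in>UNIV. f i (z $ i)) \<le> (\<Sum>i\<in>UNIV. f i ((z + t *\<^sub>R v) $ i))"
      using min by (meson is_arg_min_def not_le)
    with stacked_quadratic_upper_bound[of f L z "t *\<^sub>R v", OF diff lip] show ?thesis
      by (simp add: power_mult_distrib mult_ac)
  qed
  then have "inner ?G v = 0" by (rule linear_coefficient_zero)
  then have "inner (U ** ?G) (U ** ?G) = 0"
    using inner_transpose_matrix[of U "U ** ?G" ?G] by (simp add: v_def inner_commute)
  then show ?thesis by simp
qed

section \<open>Decay rate of the dual increments\<close>

text \<open>
  The terms with index between \<open>n / 2\<close> and \<open>n\<close> are at least \<open>V n\<close>, and their sum tends to zero by
  the Cauchy criterion.
\<close>

lemma summable_nonincreasing_times_index:
  fixes V :: "nat \<Rightarrow> real"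
  assumes "summable V" and nonneg: "\<And>k. 0 \<le> V k" and dec: "\<And>k. V (Suc k) \<le> V k"
  shows "(\<lambda>k. real k * V k) \<longlonglongrightarrow> 0"
proof (rule real_tendsto_sandwich[OF _ _ tendsto_const])
  let ?S = "\<lambda>n. sum V {..<n}"
  have "real n * V n \<le> 2 * (?S n - ?S (n div 2))" for n
  proof -
    define h where "h = real (n - n div 2)"
    have "h * V n = (\<Sum>k\<in>{n div 2..<n}. V n)" by (simp add: h_def)
    also have "\<dots> \<le> (\<Sum>k\<in>{n div 2..<n}. V k)"
      using lift_Suc_antimono_le[of V, OF dec] by (intro sum_mono) simp
    also have "\<dots> = ?S n - ?S (n div 2)"
      by (simp add: sum_diff_nat_ivl lessThan_atLeast0)
    finally have half: "h * V n \<le> ?S n - ?S (n div 2)" .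
    have "real n \<le> 2 * h" unfolding h_def by linarith
    then have "real n * V n \<le> 2 * h * V n"
      by (rule mult_right_mono[OF _ nonneg])
    also have "\<dots> \<le> 2 * (?S n - ?S (n div 2))"
      using mult_left_mono[OF half, of 2] by (simp only: mult.assoc)
    finally show ?thesis .
  qed
  then show "\<forall>\<^sub>F n in sequentially. real n * V n \<le> 2 * (?S n - ?S (n div 2))" by simp
  have "?S \<longlonglongrightarrow> suminf V" using \<open>summable V\<close> by (rule summable_LIMSEQ)
  moreover from this have "(\<lambda>n. ?S (n div 2)) \<longlonglongrightarrow> suminf V"
    by (rule filterlim_compose) (simp add: filterlim_at_top_div_const_nat)
  ultimately have "(\<lambda>n. 2 * (?S n - ?S (n div 2))) \<longlonglongrightarrow> 2 * (suminf V - suminf V)"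
    by (intro tendsto_intros)
  then show "(\<lambda>n. 2 * (?S n - ?S (n div 2))) \<longlonglongrightarrow> 0" by simp
qed (use nonneg in simp)

lemma norm_diff_squared_le: "(norm (a - b :: 'a::real_inner))\<^sup>2 \<le> 2 * (norm a)\<^sup>2 + 2 * (norm b)\<^sup>2"
proof -
  have "0 \<le> (norm (a + b))\<^sup>2" by simp
  then show ?thesis
    by (simp add: power2_norm_eq_inner inner_add_left inner_add_right inner_diff_left
        inner_diff_right inner_commute)
qed

text \<open>
  The first hypothesis comes from comparing an iterate with the optimum, the second from comparing
  consecutive iterates. The first makes \<open>\<bar>Q k - s\<bar>\<^sup>2 + \<bar>d k\<bar>\<^sup>2\<close> decrease by at least \<open>\<bar>d (k + 1)\<bar>\<^sup>2\<close>
  in each step, so that the increments are square summable. The second makes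
  \<open>\<bar>d (k + 1)\<bar>\<^sup>2 + \<bar>d (k + 1) - d k\<bar>\<^sup>2\<close> nonincreasing. In both cases the inner product is expanded by
  polarization, and the only negative term left, the square of a difference, is absorbed by the
  factor 2 on the left-hand side of the hypothesis.
\<close>

lemma increments_rate:
  fixes Q d :: "nat \<Rightarrow> 'a::real_inner"
  assumes Q: "\<And>k. Q (Suc k) = Q k + d (Suc k)"
    and optimum: "\<And>k. 2 * (norm (d (Suc k)))\<^sup>2 \<le> - inner (d (Suc k)) (Q k + d k - s)"
    and consecutive: "\<And>k. 2 * (norm (d (Suc (Suc k)) - d (Suc k)))\<^sup>2
      \<le> - inner (d (Suc (Suc k)) - d (Suc k)) (2 *\<^sub>R d (Suc k) - d k)"
  shows "(\<lambda>k. real k * ((norm (d (Suc k)))\<^sup>2 + (norm (d (Suc k) - d k))\<^sup>2)) \<longlonglongrightarrow> 0"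
proof (rule summable_nonincreasing_times_index)
  define W where "W k = (norm (Q k - s))\<^sup>2 + (norm (d k))\<^sup>2" for k
  have W: "(norm (d (Suc k)))\<^sup>2 \<le> W k - W (Suc k)" for k
  proof -
    define p u v where "p = Q k - s" and "u = d k" and "v = d (Suc k)"
    have "2 * (norm v)\<^sup>2 \<le> - inner v (p + u)"
      using optimum[of k] by (simp add: p_def u_def v_def algebra_simps)
    moreover have "(norm (v - u))\<^sup>2 \<le> 2 * (norm v)\<^sup>2 + 2 * (norm u)\<^sup>2"
      by (rule norm_diff_squared_le)
    moreover have "W (Suc k) = (norm (p + v))\<^sup>2 + (norm v)\<^sup>2" "W k = (norm p)\<^sup>2 + (norm u)\<^sup>2"
      by (simp_all add: W_def Q p_def u_def v_def algebra_simps)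
    ultimately have "(norm v)\<^sup>2 \<le> W k - W (Suc k)"
      by (simp add: power2_norm_eq_inner inner_add_left inner_add_right inner_diff_left
          inner_diff_right inner_commute)
    then show ?thesis by (simp add: v_def)
  qed
  have "(\<Sum>k<n. (norm (d (Suc k)))\<^sup>2) \<le> W 0 - W n" for n
    by (induction n) (use W in \<open>simp, smt (verit, best) sum.lessThan_Suc\<close>)
  moreover have "0 \<le> W n" for n by (simp add: W_def)
  ultimately have "(\<Sum>k<n. (norm (d (Suc k)))\<^sup>2) \<le> W 0" for n by (smt (verit))
  then have sum1: "summable (\<lambda>k. (norm (d (Suc k)))\<^sup>2)"
    by (intro summableI_nonneg_bounded) auto
  then have sum0: "summable (\<lambda>k. (norm (d k))\<^sup>2)" by (rule summable_Suc_iff[THEN iffD1])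
  show "summable (\<lambda>k. (norm (d (Suc k)))\<^sup>2 + (norm (d (Suc k) - d k))\<^sup>2)"
  proof (rule summable_comparison_test')
    show "summable (\<lambda>k. 3 * (norm (d (Suc k)))\<^sup>2 + 2 * (norm (d k))\<^sup>2)"
      using sum0 sum1 by (intro summable_add summable_mult)
    fix k
    show "norm ((norm (d (Suc k)))\<^sup>2 + (norm (d (Suc k) - d k))\<^sup>2)
        \<le> 3 * (norm (d (Suc k)))\<^sup>2 + 2 * (norm (d k))\<^sup>2"
      using norm_diff_squared_le[of "d (Suc k)" "d k"] by simp
  qed
next
  fix k
  define u v e where "u = d (Suc k)" and "v = d (Suc (Suc k)) - d (Suc k)" and "e = d (Suc k) - d k"
  have "2 * (norm v)\<^sup>2 \<le> - inner v (u + e)"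
    using consecutive[of k] by (simp add: u_def v_def e_def scaleR_2 add_diff_eq)
  moreover have "(norm (v - e))\<^sup>2 \<le> 2 * (norm v)\<^sup>2 + 2 * (norm e)\<^sup>2"
    by (rule norm_diff_squared_le)
  moreover have "0 \<le> (norm v)\<^sup>2" by simp
  ultimately have "(norm (u + v))\<^sup>2 + (norm v)\<^sup>2 \<le> (norm u)\<^sup>2 + (norm e)\<^sup>2"
    unfolding power2_norm_eq_inner inner_add_left inner_add_right inner_diff_left
      inner_diff_right inner_commute[of e v] inner_commute[of u v] by linarith
  then show "(norm (d (Suc (Suc k))))\<^sup>2 + (norm (d (Suc (Suc k)) - d (Suc k)))\<^sup>2
      \<le> (norm (d (Suc k)))\<^sup>2 + (norm (d (Suc k) - d k))\<^sup>2"
    by (simp add: u_def v_def e_def)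
qed simp

lemma little_o_inverseI:
  assumes nonneg: "\<And>k. 0 \<le> a k" and le: "\<And>k. a k \<le> C * V k"
    and V: "(\<lambda>k. real k * V k) \<longlonglongrightarrow> 0"
  shows "little_o_inverse a"
proof -
  have "(\<lambda>k. real k * a k) \<longlonglongrightarrow> 0"
  proof (rule real_tendsto_sandwich[OF _ _ tendsto_const])
    have "real k * a k \<le> C * (real k * V k)" for k
      using mult_left_mono[OF le[of k], of "real k"] by (simp add: mult_ac)
    then show "\<forall>\<^sub>F k in sequentially. real k * a k \<le> C * (real k * V k)" by simp
    show "(\<lambda>k. C * (real k * V k)) \<longlonglongrightarrow> 0" using tendsto_mult_left[OF V, of C] by simp
  qed (use nonneg in simp)
  then have "(\<lambda>k. ereal (real k * a k)) \<longlonglongrightarrow> ereal 0" by (rule tendsto_ereal)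
  then have "limsup (\<lambda>k. ereal (real k * a k)) = 0"
    unfolding zero_ereal_def by (intro lim_imp_Limsup) simp_all
  with nonneg show ?thesis by (simp add: little_o_inverse_def)
qed

section \<open>The iteration in dual form\<close>

text \<open>
  Compatibility with the graph turns the sum over a closed neighborhood into a matrix product, and
  induction gives \<open>y = U\<^sup>T q\<close> at every index. The extrapolation \<open>2 y k - y (k - 1)\<close> then becomes the
  image of \<open>q k\<close> plus its last increment.
\<close>

lemma mirror_extra_dual_form:
  fixes U :: "real^'n::finite^'m::finite" and x :: "nat \<Rightarrow> real^'p::finite^'n"
  assumes compatible: "graph_compatible E (transpose U ** U)"
    and iterates: "mirror_extra f r E (transpose U ** U) c x y"
    and dual: "dual_sequence f U x q"
  shows "x (Suc k) = r - c *\<^sub>R (transpose U ** (q (int k) + U ** stacked_gradient f (x k)))"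
proof -
  let ?A = "transpose U ** U"
  have y_step: "y (int k) = y (int k - 1) + transpose U ** (U ** stacked_gradient f (x k))" for k
  proof (rule vec_eq_iff[THEN iffD2], rule allI)
    fix i
    have "(\<Sum>j\<in>neighbors E i \<union> {i}. ?A $ i $ j *\<^sub>R gradient (f j) (x k $ j))
        = (\<Sum>j\<in>UNIV. ?A $ i $ j *\<^sub>R gradient (f j) (x k $ j))"
      using compatible by (intro sum.mono_neutral_left) (auto simp: graph_compatible_def neighbors_def)
    also have "\<dots> = (?A ** stacked_gradient f (x k)) $ i"
      by (simp add: vec_eq_iff stacked_gradient_def matrix_matrix_mult_def[of ?A])
    finally show "y (int k) $ i = (y (int k - 1) + transpose U ** (U ** stacked_gradient f (x k))) $ i"
      using iterates by (simp add: mirror_extra_def matrix_mul_assoc)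
  qed
  have q_step: "q (int k) = q (int k - 1) + U ** stacked_gradient f (x k)" for k
    using dual by (simp add: dual_sequence_def)
  have y_q: "y (int k - 1) = transpose U ** q (int k - 1)" for k
  proof (induction k)
    case 0
    have "y (- 1) = 0" using iterates by (simp add: mirror_extra_def vec_eq_iff)
    moreover have "q (- 1) = 0" using dual by (simp add: dual_sequence_def)
    ultimately show ?case by simp
  next
    case (Suc k)
    then show ?case by (simp add: y_step[of k] q_step[of k] matrix_add_ldistrib)
  qed
  have "x (Suc k) = r - (2 * c) *\<^sub>R y (int k) + c *\<^sub>R y (int k - 1)"
    using iterates by (simp add: mirror_extra_def vec_eq_iff)
  also have "\<dots> = r - c *\<^sub>R (transpose U ** (q (int k) + U ** stacked_gradient f (x k)))"
    unfolding y_step[of k] y_q q_step[of k] matrix_add_ldistrib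
    by (simp add: vec_eq_iff algebra_simps)
  finally show ?thesis .
qed

text \<open>
  Cocoercivity between two points whose difference lies in the range of the transpose of U becomes
  an inequality between dual quantities only, with the step size cancelled.
\<close>

lemma dual_step_inequality:
  fixes U :: "real^'n::finite^'m::finite" and H :: "real^'p::finite^'n"
  assumes "0 < c" "2 * c * (norm (U ** H))\<^sup>2 \<le> inner H X" "X = - (c *\<^sub>R (transpose U ** w))"
  shows "2 * (norm (U ** H))\<^sup>2 \<le> - inner (U ** H) w"
proof -
  have "c * (2 * (norm (U ** H))\<^sup>2) \<le> c * (- inner (U ** H) w)"
    using assms(2,3) inner_transpose_matrix[of U w H] by (simp add: inner_commute mult_ac)
  with \<open>0 < c\<close> show ?thesis by (simp only: mult_le_cancel_left_pos)
qed

theorem theorem5: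
  fixes f :: "'n::finite \<Rightarrow> real^'p::finite \<Rightarrow> real"
    and r :: "real^'p^'n"
    and E :: "'n set set"
    and Lmat :: "real^'n^'n"
    and U :: "real^'n^'m::finite"
    and Lip :: "'n \<Rightarrow> real"
    and L c :: real
    and x :: "nat \<Rightarrow> real^'p^'n"
    and y :: "int \<Rightarrow> real^'p^'n"
    and q :: "int \<Rightarrow> real^'p^'m"
  assumes convex: "\<And>i. convex_on UNIV (f i)"
    and differentiable: "\<And>i z. f i differentiable (at z)"
    and lipschitz: "\<And>i. (Lip i)-lipschitz_on UNIV (gradient (f i))"
    and graph: "simple_graph E" "connected_graph E"
    and compatible: "graph_compatible E Lmat"
    and factorization: "Lmat = transpose U ** U"
    and rows: "CARD('m) = CARD('n) - 1"
    and full_row_rank: "rank U = CARD('m)"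
    and null_space: "{v. U *v v = 0} = {a *\<^sub>R 1 | a. True}"
    and solution: "\<exists>z::real^'p^'n.
      is_arg_min (\<lambda>z. \<Sum>i\<in>UNIV. f i (z $ i)) (\<lambda>z. (\<Sum>i\<in>UNIV. z $ i - r $ i) = 0) z"
    and L: "L = Max (range Lip)"
    and c_pos: "0 < c"
    \<comment> \<open>in the extended reals \<open>1 / 0 = \<infinity>\<close>, so \<open>L = 0\<close> imposes no upper bound on \<open>c\<close>\<close>
    and c_bound: "ereal c < 1 / ereal (2 * L * lambda_max Lmat)"
    and iterates: "mirror_extra f r E Lmat c x y"
    and dual: "dual_sequence f U x q"
  shows "little_o_inverse (\<lambda>k. (norm (U ** stacked_gradient f (x (k + 1))))\<^sup>2) \<and>
         little_o_inverse (\<lambda>k. (norm (x (k + 1) - r + c *\<^sub>R (transpose U ** q (int k + 1))))\<^sup>2)"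
proof -
  define G where "G = stacked_gradient f"
  define d where "d k = U ** G (x k)" for k
  define Q where "Q k = q (int k)" for k :: nat
  define \<Lambda> where "\<Lambda> = lambda_max Lmat"
  have mult_diff: "M ** (A - B) = M ** A - M ** B"
    for M :: "real^'a::finite^'b::finite" and A B :: "real^'p^'a"
    by (rule linear_diff[OF linear_matrix_mult])
  have mult_scaleR: "M ** (t *\<^sub>R A) = t *\<^sub>R (M ** A)"
    for M :: "real^'a::finite^'b::finite" and A :: "real^'p^'a" and t
    by (rule linear_scale[OF linear_matrix_mult])
  have "Lip i \<le> L" for i unfolding L by (intro Max_ge) auto
  then have lip: "L-lipschitz_on UNIV (gradient (f i))" for i
    using lipschitz lipschitz_on_le by blast
  have "U *v (1 *\<^sub>R 1) = 0" using null_space by blast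
  then have one: "U *v 1 = 0" by simp

  have "(norm (U ** (1 :: real^'p^'n)))\<^sup>2 \<le> \<Lambda> * (norm (1 :: real^'p^'n))\<^sup>2"
    unfolding \<Lambda>_def factorization by (rule norm_factor_mult_le)
  then have "0 \<le> \<Lambda> * (norm (1 :: real^'p^'n))\<^sup>2" by (rule order_trans[rotated]) simp
  then have \<Lambda>: "0 \<le> \<Lambda>" by (simp add: zero_le_mult_iff)
  have step: "2 * c * \<Lambda> * L \<le> 1"
  proof (cases "2 * L * \<Lambda> \<le> 0")
    case True
    then have "c * (2 * L * \<Lambda>) \<le> 0" using c_pos by (simp add: mult_le_0_iff)
    then show ?thesis by (simp add: mult_ac)
  next
    case False
    then have "c < 1 / (2 * L * \<Lambda>)"
      using c_bound unfolding \<Lambda>_def[symmetric] one_ereal_def by (auto split: if_splits)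
    with False show ?thesis by (simp add: field_simps)
  qed
  \<comment> \<open>the step size bound is what lets the dual norm, scaled by \<open>2 c\<close>, replace the norm in cocoercivity\<close>
  have key: "2 * c * (norm (U ** (G a - G b)))\<^sup>2 \<le> inner (G a - G b) (a - b)" for a b
  proof -
    let ?H = "G a - G b" and ?m = "inner (G a - G b) (a - b)"
    have coco: "(norm ?H)\<^sup>2 \<le> L * ?m"
      unfolding G_def by (rule stacked_gradient_cocoercive[OF convex differentiable lip])
    have m: "0 \<le> ?m"
    proof (cases "L = 0")
      case True
      with coco have "?H = 0" by simp
      then show ?thesis by (simp only: inner_zero_left)
    next
      case False
      then have "0 < L" using lipschitz_on_nonneg[OF lip] by (simp add: less_le)
      moreover have "0 \<le> L * ?m" using coco by (rule order_trans[rotated]) simp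
      ultimately show ?thesis by (simp add: zero_le_mult_iff)
    qed
    have "2 * c * (norm (U ** ?H))\<^sup>2 \<le> 2 * c * (\<Lambda> * (norm ?H)\<^sup>2)"
      using c_pos norm_factor_mult_le[of U ?H] by (simp add: \<Lambda>_def factorization)
    also have "\<dots> \<le> 2 * c * (\<Lambda> * (L * ?m))"
      using c_pos \<Lambda> coco by (intro mult_left_mono) auto
    also have "\<dots> = (2 * c * \<Lambda> * L) * ?m" by (simp add: mult_ac)
    also have "\<dots> \<le> ?m" using mult_right_mono[OF step m] by simp
    finally show ?thesis .
  qed

  obtain z where z: "is_arg_min (\<lambda>z. \<Sum>i\<in>UNIV. f i (z $ i)) (\<lambda>z. (\<Sum>i\<in>UNIV. z $ i - r $ i) = 0) z"
    using solution by blast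
  have Gz: "U ** G z = 0"
    unfolding G_def by (rule minimizer_gradient_consensus[OF differentiable lip one z])
  have "(\<Sum>i\<in>UNIV. (z - r) $ i) = 0" using z by (simp add: is_arg_min_def)
  then obtain S where S: "z - r = transpose U ** S"
    using zero_row_sum_in_range[OF null_space] by blast
  \<comment> \<open>the dual optimum: \<open>s\<close> satisfies \<open>z - r + c U\<^sup>T s = 0\<close>\<close>
  define s where "s = - (1 / c) *\<^sub>R S"
  have zs: "z = r - c *\<^sub>R (transpose U ** s)"
  proof -
    have "c *\<^sub>R (transpose U ** s) = - (z - r)"
      unfolding s_def mult_scaleR S using c_pos by simp
    then show ?thesis by simp
  qed

  have x_Suc: "x (Suc k) = r - c *\<^sub>R (transpose U ** (Q k + d k))" for k
    using mirror_extra_dual_form[OF _ _ dual] compatible iterates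
    by (simp add: factorization Q_def d_def G_def)
  have Q_Suc: "Q (Suc k) = Q k + d (Suc k)" for k
    using dual unfolding dual_sequence_def Q_def d_def G_def
    by (metis add_diff_cancel_left' of_nat_Suc)
  have rate: "(\<lambda>k. real k * ((norm (d (Suc k)))\<^sup>2 + (norm (d (Suc k) - d k))\<^sup>2)) \<longlonglongrightarrow> 0"
  proof (rule increments_rate[of Q d s, OF Q_Suc])
    fix k
    have "x (Suc k) - z = - (c *\<^sub>R (transpose U ** (Q k + d k - s)))"
      unfolding x_Suc zs by (simp add: mult_diff scaleR_diff_right)
    from dual_step_inequality[OF c_pos key this]
    show "2 * (norm (d (Suc k)))\<^sup>2 \<le> - inner (d (Suc k)) (Q k + d k - s)"
      by (simp add: mult_diff Gz d_def)
    have "x (Suc (Suc k)) - x (Suc k) = - (c *\<^sub>R (transpose U ** (2 *\<^sub>R d (Suc k) - d k)))"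
      unfolding x_Suc Q_Suc mult_diff mult_scaleR matrix_add_ldistrib
      by (simp add: vec_eq_iff algebra_simps)
    from dual_step_inequality[OF c_pos key this]
    show "2 * (norm (d (Suc (Suc k)) - d (Suc k)))\<^sup>2
        \<le> - inner (d (Suc (Suc k)) - d (Suc k)) (2 *\<^sub>R d (Suc k) - d k)"
      by (simp add: mult_diff d_def)
  qed

  have "linear (\<lambda>e :: real^'p^'m. c *\<^sub>R (transpose U ** e))"
    by (intro linear_compose_scale_right linear_matrix_mult)
  then obtain B where B: "norm (c *\<^sub>R (transpose U ** e)) \<le> B * norm e" for e :: "real^'p^'m"
    using linear_bounded by blast
  \<comment> \<open>the primal residual is a second difference of the dual sequence, so the same rate covers it\<close>
  have primal: "x (k + 1) - r + c *\<^sub>R (transpose U ** q (int k + 1))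
      = c *\<^sub>R (transpose U ** (d (Suc k) - d k))" for k
  proof -
    have "q (int k + 1) = Q k + d (Suc k)" using Q_Suc[of k] by (simp add: Q_def add.commute)
    then show ?thesis
      by (simp add: x_Suc mult_diff matrix_add_ldistrib algebra_simps)
  qed
  show ?thesis
  proof
    show "little_o_inverse (\<lambda>k. (norm (U ** stacked_gradient f (x (k + 1))))\<^sup>2)"
      by (rule little_o_inverseI[where C = 1, OF _ _ rate]) (simp_all add: d_def G_def)
    show "little_o_inverse (\<lambda>k. (norm (x (k + 1) - r + c *\<^sub>R (transpose U ** q (int k + 1))))\<^sup>2)"
    proof (rule little_o_inverseI[where C = "B\<^sup>2", OF _ _ rate])
      fix k
      have "(norm (c *\<^sub>R (transpose U ** (d (Suc k) - d k))))\<^sup>2 \<le> (B * norm (d (Suc k) - d k))\<^sup>2"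
        by (intro power_mono B) simp
      also have "\<dots> \<le> B\<^sup>2 * ((norm (d (Suc k)))\<^sup>2 + (norm (d (Suc k) - d k))\<^sup>2)"
        by (simp add: power_mult_distrib mult_left_mono)
      finally show "(norm (x (k + 1) - r + c *\<^sub>R (transpose U ** q (int k + 1))))\<^sup>2
          \<le> B\<^sup>2 * ((norm (d (Suc k)))\<^sup>2 + (norm (d (Suc k) - d k))\<^sup>2)"
        unfolding primal .
    qed simp
  qed
qed

end
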